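(* In the binary random graph affiliation mixture model with $Q\ge 2$ groups, for any fixed and known values $\pi_q\in(0,1)$, $1\le q\le Q$, the parameters $\alpha,\beta$ are identifiable from the joint distribution of $K_3$: if $(\alpha,\beta)$ and $(\alpha',\beta')$ together with the same $\boldsymbol\pi$ induce the same law of $K_3$, then $(\alpha,\beta)=(\alpha',\beta')$.
   Context: Random graph mixture model: nodes have i.i.d. latent groups $Z_i\in\{1,\dots,Q\}$ with $\pi_q=\mathbb P(Z_i=q)\in(0,1)$, $\sum_q\pi_q=1$; edge variables $X_{ij}$ ($i<j$) are conditionally independent given all $Z$'s, with law of $X_{ij}$ depending only on $(Z_i,Z_j)$. Binary affiliation model: $X_{ij}\in\{0,1\}$ with $\mathbb P(X_{ij}=1\mid Z_i=q,Z_j=l)=\alpha$ if $q=l$ and $=\beta$ if $q\ne l$. $K_n$ denotes the collection of the $\binom n2$ edge variables among a set of $n$ nodes. *)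

theory Defs
  imports Complex_Main
begin

text \<open>Groups are indexed by 0,...,Q-1 (the paper's 1,...,Q).
  Bernoulli probability of outcome x (True = edge present).\<close>
definition bern :: "real \<Rightarrow> bool \<Rightarrow> real" where
  "bern p x = (if x then p else 1 - p)"

definition affil :: "real \<Rightarrow> real \<Rightarrow> nat \<Rightarrow> nat \<Rightarrow> real" where
  "affil \<alpha> \<beta> q l = (if q = l then \<alpha> else \<beta>)"

definition K3_law :: "nat \<Rightarrow> (nat \<Rightarrow> real) \<Rightarrow> real \<Rightarrow> real \<Rightarrow> bool \<times> bool \<times> bool \<Rightarrow> real" where
  "K3_law Q \<pi> \<alpha> \<beta> x =
     (case x of (x12, x13, x23) \<Rightarrow>
       (\<Sum>q1<Q. \<Sum>q2<Q. \<Sum>q3<Q.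
          \<pi> q1 * \<pi> q2 * \<pi> q3 *
          bern (affil \<alpha> \<beta> q1 q2) x12 *
          bern (affil \<alpha> \<beta> q1 q3) x13 *
          bern (affil \<alpha> \<beta> q2 q3) x23))"

end

theory Submission
  imports Defs
begin

(*
  Write delta = alpha - beta and s_k = sum_q pi_q^k.  Three events of K_3 have
  probabilities that are polynomials in beta and delta:
    m1 = P(X12 = 1)              = beta + delta s_2,
    m2 = P(X12 = X13 = 1)        = beta^2 + 2 beta delta s_2 + delta^2 s_3,
    m3 = P(X12 = X13 = X23 = 1)  = beta^3 + 3 beta^2 delta s_2 + (3 beta delta^2 + delta^3) s_3.
  Like a third cumulant, m3 - 3 m1 m2 + 2 m1^3 = delta^3 W with W = s_3 - 3 s_2 s_3 + 2 s_2^3.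
  Hence equal laws give equal delta^3, so equal delta, and then m1 gives equal beta,
  provided W is nonzero.  W > 0 follows from 0 < s_2 < 1 and s_3 <= s_2^(3/2).
*)

definition power_sum :: "nat \<Rightarrow> (nat \<Rightarrow> real) \<Rightarrow> nat \<Rightarrow> real" where
  "power_sum Q \<pi> k = (\<Sum>q<Q. \<pi> q ^ k)"

definition edge_prob :: "(bool \<times> bool \<times> bool \<Rightarrow> real) \<Rightarrow> real" where
  "edge_prob P = (\<Sum>y\<in>UNIV. \<Sum>z\<in>UNIV. P (True, y, z))"

definition two_star_prob :: "(bool \<times> bool \<times> bool \<Rightarrow> real) \<Rightarrow> real" where
  "two_star_prob P = (\<Sum>z\<in>UNIV. P (True, True, z))"

definition triangle_prob :: "(bool \<times> bool \<times> bool \<Rightarrow> real) \<Rightarrow> real" where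
  "triangle_prob P = P (True, True, True)"

lemma mean_affil:
  assumes "(\<Sum>q<Q. \<pi> q) = 1" "q < Q"
  shows "(\<Sum>l<Q. \<pi> l * affil \<alpha> \<beta> q l) = \<beta> + (\<alpha> - \<beta>) * \<pi> q"
proof -
  have "(\<Sum>l<Q. \<pi> l * affil \<alpha> \<beta> q l)
      = (\<Sum>l<Q. \<beta> * \<pi> l + (\<alpha> - \<beta>) * (if q = l then \<pi> l else 0))"
    by (intro sum.cong) (auto simp: affil_def algebra_simps)
  also have "\<dots> = \<beta> * (\<Sum>l<Q. \<pi> l) + (\<alpha> - \<beta>) * \<pi> q"
    using assms(2) by (simp add: sum.distrib flip: sum_distrib_left)
  finally show ?thesis using assms(1) by simp
qed

lemma mean_affil_product:
  assumes "(\<Sum>q<Q. \<pi> q) = 1" "q < Q" "r < Q"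
  shows "(\<Sum>l<Q. \<pi> l * affil \<alpha> \<beta> q l * affil \<alpha> \<beta> r l)
       = \<beta>^2 + \<beta> * (\<alpha> - \<beta>) * (\<pi> q + \<pi> r) + (\<alpha> - \<beta>)^2 * (if q = r then \<pi> q else 0)"
proof -
  have "(\<Sum>l<Q. \<pi> l * affil \<alpha> \<beta> q l * affil \<alpha> \<beta> r l)
      = (\<Sum>l<Q. \<beta>^2 * \<pi> l + \<beta> * (\<alpha> - \<beta>) * (if q = l then \<pi> l else 0)
           + \<beta> * (\<alpha> - \<beta>) * (if r = l then \<pi> l else 0)
           + (\<alpha> - \<beta>)^2 * (if q = l then if r = l then \<pi> l else 0 else 0))"
    by (intro sum.cong) (auto simp: affil_def power2_eq_square algebra_simps)
  also have "\<dots> = \<beta>^2 * (\<Sum>l<Q. \<pi> l) + \<beta> * (\<alpha> - \<beta>) * \<pi> q + \<beta> * (\<alpha> - \<beta>) * \<pi> r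
           + (\<alpha> - \<beta>)^2 * (if q = r then \<pi> q else 0)"
    using assms(2,3) by (simp add: sum.distrib flip: sum_distrib_left)
  finally show ?thesis using assms(1) by (simp add: algebra_simps)
qed

lemma triangle_row:
  assumes "(\<Sum>q<Q. \<pi> q) = 1" "q < Q"
  shows "(\<Sum>r<Q. \<pi> r * affil \<alpha> \<beta> q r * (\<Sum>l<Q. \<pi> l * affil \<alpha> \<beta> q l * affil \<alpha> \<beta> r l))
       = \<beta>^3 + \<beta>^2 * (\<alpha> - \<beta>) * (\<pi> q + power_sum Q \<pi> 2)
         + \<pi> q * ((\<alpha> - \<beta>) * \<beta>^2 + (3 * \<beta> * (\<alpha> - \<beta>)^2 + (\<alpha> - \<beta>)^3) * \<pi> q)"
proof -
  let ?d = "\<alpha> - \<beta>"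
  have "(\<Sum>r<Q. \<pi> r * affil \<alpha> \<beta> q r * (\<Sum>l<Q. \<pi> l * affil \<alpha> \<beta> q l * affil \<alpha> \<beta> r l))
      = (\<Sum>r<Q. \<pi> r * affil \<alpha> \<beta> q r *
          (\<beta>^2 + \<beta> * ?d * (\<pi> q + \<pi> r) + ?d^2 * (if q = r then \<pi> q else 0)))"
    using assms by (intro sum.cong refl) (simp add: mean_affil_product)
  also have "\<dots> = (\<Sum>r<Q. \<beta>^3 * \<pi> r + (\<beta>^2 * ?d * \<pi> q) * \<pi> r + \<beta>^2 * ?d * \<pi> r^2
          + (if q = r then \<pi> r * (?d * \<beta>^2 + (3 * \<beta> * ?d^2 + ?d^3) * \<pi> q) else 0))"
    by (intro sum.cong refl) (auto simp: affil_def power2_eq_square power3_eq_cube algebra_simps)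
  also have "\<dots> = \<beta>^3 * (\<Sum>r<Q. \<pi> r) + (\<beta>^2 * ?d * \<pi> q) * (\<Sum>r<Q. \<pi> r)
      + \<beta>^2 * ?d * power_sum Q \<pi> 2 + \<pi> q * (?d * \<beta>^2 + (3 * \<beta> * ?d^2 + ?d^3) * \<pi> q)"
    using assms(2) by (simp add: power_sum_def sum.distrib flip: sum_distrib_left)
  finally show ?thesis using assms(1) by (simp add: algebra_simps)
qed

lemma K3_law_forget_last:
  "(\<Sum>z\<in>UNIV. K3_law Q \<pi> \<alpha> \<beta> (x, y, z)) =
   (\<Sum>q1<Q. \<Sum>q2<Q. \<Sum>q3<Q. \<pi> q1 * \<pi> q2 * \<pi> q3 *
      bern (affil \<alpha> \<beta> q1 q2) x * bern (affil \<alpha> \<beta> q1 q3) y)"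
  unfolding K3_law_def UNIV_bool
  by (simp add: sum.distrib[symmetric] bern_def algebra_simps)

lemma edge_prob_K3:
  assumes "(\<Sum>q<Q. \<pi> q) = 1"
  shows "edge_prob (K3_law Q \<pi> \<alpha> \<beta>) = \<beta> + (\<alpha> - \<beta>) * power_sum Q \<pi> 2"
proof -
  have "edge_prob (K3_law Q \<pi> \<alpha> \<beta>)
      = (\<Sum>q1<Q. \<pi> q1 * (\<Sum>q2<Q. \<pi> q2 * affil \<alpha> \<beta> q1 q2) * (\<Sum>q3<Q. \<pi> q3))"
    unfolding edge_prob_def K3_law_forget_last
    by (simp add: UNIV_bool bern_def sum_distrib_left sum_distrib_right sum.distrib[symmetric]
        algebra_simps)
  also have "\<dots> = (\<Sum>q<Q. \<beta> * \<pi> q + (\<alpha> - \<beta>) * \<pi> q^2)"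
    using assms by (intro sum.cong refl) (simp add: mean_affil power2_eq_square algebra_simps)
  finally show ?thesis
    using assms by (simp add: power_sum_def sum.distrib flip: sum_distrib_left)
qed

lemma two_star_prob_K3:
  assumes "(\<Sum>q<Q. \<pi> q) = 1"
  shows "two_star_prob (K3_law Q \<pi> \<alpha> \<beta>)
       = \<beta>^2 + 2 * \<beta> * (\<alpha> - \<beta>) * power_sum Q \<pi> 2 + (\<alpha> - \<beta>)^2 * power_sum Q \<pi> 3"
proof -
  have "two_star_prob (K3_law Q \<pi> \<alpha> \<beta>)
      = (\<Sum>q1<Q. \<pi> q1 * (\<Sum>q2<Q. \<pi> q2 * affil \<alpha> \<beta> q1 q2) * (\<Sum>q3<Q. \<pi> q3 * affil \<alpha> \<beta> q1 q3))"
    unfolding two_star_prob_def K3_law_forget_last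
    by (simp add: bern_def sum_distrib_left sum_distrib_right mult_ac)
  also have "\<dots> = (\<Sum>q<Q. \<beta>^2 * \<pi> q + 2 * \<beta> * (\<alpha> - \<beta>) * \<pi> q^2 + (\<alpha> - \<beta>)^2 * \<pi> q^3)"
    using assms by (intro sum.cong refl)
      (simp add: mean_affil power2_eq_square power3_eq_cube algebra_simps)
  finally show ?thesis
    using assms by (simp add: power_sum_def sum.distrib flip: sum_distrib_left)
qed

lemma triangle_prob_K3:
  assumes "(\<Sum>q<Q. \<pi> q) = 1"
  shows "triangle_prob (K3_law Q \<pi> \<alpha> \<beta>)
       = \<beta>^3 + 3 * \<beta>^2 * (\<alpha> - \<beta>) * power_sum Q \<pi> 2
         + (3 * \<beta> * (\<alpha> - \<beta>)^2 + (\<alpha> - \<beta>)^3) * power_sum Q \<pi> 3"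
proof -
  let ?d = "\<alpha> - \<beta>" and ?s2 = "power_sum Q \<pi> 2"
  have "triangle_prob (K3_law Q \<pi> \<alpha> \<beta>) = (\<Sum>q<Q. \<pi> q *
      (\<Sum>r<Q. \<pi> r * affil \<alpha> \<beta> q r * (\<Sum>l<Q. \<pi> l * affil \<alpha> \<beta> q l * affil \<alpha> \<beta> r l)))"
    unfolding triangle_prob_def K3_law_def by (simp add: bern_def sum_distrib_left mult_ac)
  also have "\<dots> = (\<Sum>q<Q. (\<beta>^3 + \<beta>^2 * ?d * ?s2) * \<pi> q + 2 * \<beta>^2 * ?d * \<pi> q^2
      + (3 * \<beta> * ?d^2 + ?d^3) * \<pi> q^3)"
  proof (intro sum.cong refl)
    fix q assume "q \<in> {..<Q}"
    then have q: "q < Q" by simp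
    show "\<pi> q * (\<Sum>r<Q. \<pi> r * affil \<alpha> \<beta> q r * (\<Sum>l<Q. \<pi> l * affil \<alpha> \<beta> q l * affil \<alpha> \<beta> r l))
      = (\<beta>^3 + \<beta>^2 * ?d * ?s2) * \<pi> q + 2 * \<beta>^2 * ?d * \<pi> q^2 + (3 * \<beta> * ?d^2 + ?d^3) * \<pi> q^3"
      unfolding triangle_row[OF assms q] by (simp add: power2_eq_square power3_eq_cube algebra_simps)
  qed
  also have "\<dots> = (\<beta>^3 + \<beta>^2 * ?d * ?s2) * (\<Sum>q<Q. \<pi> q) + 2 * \<beta>^2 * ?d * ?s2
      + (3 * \<beta> * ?d^2 + ?d^3) * power_sum Q \<pi> 3"
    by (simp add: power_sum_def sum.distrib flip: sum_distrib_left)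
  finally show ?thesis using assms by (simp add: algebra_simps)
qed

text \<open>Algebraic core: the cumulant-like combination m3 - 3 m1 m2 + 2 m1^3 of the three
  moment polynomials equals d^3 W, so when W is nonzero the moments determine d and then b.\<close>
lemma moments_determine_parameters:
  fixes b d b' d' s2 s3 :: real
  assumes W: "s3 - 3 * s2 * s3 + 2 * s2^3 \<noteq> 0"
    and m1: "b + d * s2 = b' + d' * s2"
    and m2: "b^2 + 2 * b * d * s2 + d^2 * s3 = b'^2 + 2 * b' * d' * s2 + d'^2 * s3"
    and m3: "b^3 + 3 * b^2 * d * s2 + (3 * b * d^2 + d^3) * s3
           = b'^3 + 3 * b'^2 * d' * s2 + (3 * b' * d'^2 + d'^3) * s3"
  shows "b = b' \<and> d = d'"
proof -
  have cumulant: "(b^3 + 3 * b^2 * d * s2 + (3 * b * d^2 + d^3) * s3)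
      - 3 * (b + d * s2) * (b^2 + 2 * b * d * s2 + d^2 * s3) + 2 * (b + d * s2)^3
      = d^3 * (s3 - 3 * s2 * s3 + 2 * s2^3)" for b d
    by (simp add: power2_eq_square power3_eq_cube algebra_simps)
  have "d^3 * (s3 - 3 * s2 * s3 + 2 * s2^3)
      = (b^3 + 3 * b^2 * d * s2 + (3 * b * d^2 + d^3) * s3)
        - 3 * (b + d * s2) * (b^2 + 2 * b * d * s2 + d^2 * s3) + 2 * (b + d * s2)^3"
    by (rule cumulant[symmetric])
  also have "\<dots> = (b'^3 + 3 * b'^2 * d' * s2 + (3 * b' * d'^2 + d'^3) * s3)
        - 3 * (b' + d' * s2) * (b'^2 + 2 * b' * d' * s2 + d'^2 * s3) + 2 * (b' + d' * s2)^3"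
    by (simp only: m1 m2 m3)
  also have "\<dots> = d'^3 * (s3 - 3 * s2 * s3 + 2 * s2^3)"
    by (rule cumulant)
  finally have "d^3 * (s3 - 3 * s2 * s3 + 2 * s2^3) = d'^3 * (s3 - 3 * s2 * s3 + 2 * s2^3)" .
  then have "d^3 = d'^3" using W by simp
  then have "d = d'" by (metis odd_real_root_unique odd_numeral)
  with m1 show ?thesis by simp
qed

text \<open>W = s - 3 u^2 s + 2 u^6 is affine in s and positive at s = 0 and at s = u^3
  (where it equals u^3 (1 - u)^2 (1 + 2 u)), hence on the whole interval.\<close>
lemma cubic_cumulant_pos:
  fixes u s :: real
  assumes u: "0 < u" "u < 1" and s: "0 \<le> s" "s \<le> u^3"
  shows "s - 3 * u^2 * s + 2 * (u^2)^3 > 0"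
proof -
  have linear: "s - 3 * u^2 * s + 2 * (u^2)^3 = s * (1 - 3 * u^2) + 2 * (u^2)^3"
    by (simp add: algebra_simps)
  show ?thesis
  proof (cases "1 - 3 * u^2 \<ge> 0")
    case True
    then have "s * (1 - 3 * u^2) \<ge> 0" using s by simp
    moreover have "(u^2)^3 > 0" using u by simp
    ultimately show ?thesis unfolding linear by linarith
  next
    case False
    then have "s * (1 - 3 * u^2) \<ge> u^3 * (1 - 3 * u^2)"
      using s by (intro mult_right_mono_neg) auto
    moreover have "u^3 * (1 - 3 * u^2) + 2 * (u^2)^3 = u^3 * ((1 - u)^2 * (1 + 2 * u))"
      by (simp add: power2_eq_square power3_eq_cube algebra_simps)
    moreover have "u^3 * ((1 - u)^2 * (1 + 2 * u)) > 0" using u by simp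
    ultimately show ?thesis unfolding linear by linarith
  qed
qed

text \<open>For nonnegative weights every weight is at most sqrt s_2, so s_3 \<le> s_2 sqrt s_2.\<close>
lemma power_sum_3_le:
  assumes "\<forall>q<Q. 0 \<le> \<pi> q"
  shows "power_sum Q \<pi> 3 \<le> power_sum Q \<pi> 2 * sqrt (power_sum Q \<pi> 2)"
proof -
  have max_le: "\<pi> q \<le> sqrt (power_sum Q \<pi> 2)" if "q < Q" for q
  proof -
    have "\<pi> q^2 \<le> power_sum Q \<pi> 2"
      unfolding power_sum_def using that by (intro member_le_sum) auto
    then show ?thesis using assms that by (simp add: real_le_rsqrt)
  qed
  have "\<pi> q^3 \<le> \<pi> q^2 * sqrt (power_sum Q \<pi> 2)" if "q < Q" for q
    using mult_left_mono[OF max_le[OF that], of "\<pi> q^2"]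
    by (simp add: power2_eq_square power3_eq_cube)
  then have "power_sum Q \<pi> 3 \<le> (\<Sum>q<Q. \<pi> q^2 * sqrt (power_sum Q \<pi> 2))"
    unfolding power_sum_def[of Q \<pi> 3] by (intro sum_mono) simp
  then show ?thesis by (simp add: power_sum_def sum_distrib_right)
qed

lemma power_sum_2_bounds:
  assumes "\<forall>q<Q. 0 < \<pi> q \<and> \<pi> q < 1" "(\<Sum>q<Q. \<pi> q) = 1"
  shows "0 < power_sum Q \<pi> 2" "power_sum Q \<pi> 2 < 1"
proof -
  have "{..<Q} \<noteq> {}" using assms(2) by auto
  then show "0 < power_sum Q \<pi> 2"
    unfolding power_sum_def using assms(1) by (intro sum_pos) auto
  have "power_sum Q \<pi> 2 < (\<Sum>q<Q. \<pi> q)"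
    unfolding power_sum_def using assms(1) \<open>{..<Q} \<noteq> {}\<close>
    by (intro sum_strict_mono) (auto simp: power2_eq_square)
  then show "power_sum Q \<pi> 2 < 1" using assms(2) by simp
qed

lemma power_sum_cumulant_pos:
  assumes "\<forall>q<Q. 0 < \<pi> q \<and> \<pi> q < 1" "(\<Sum>q<Q. \<pi> q) = 1"
  shows "power_sum Q \<pi> 3 - 3 * power_sum Q \<pi> 2 * power_sum Q \<pi> 3 + 2 * power_sum Q \<pi> 2 ^ 3 > 0"
proof -
  define u where "u = sqrt (power_sum Q \<pi> 2)"
  have s2: "power_sum Q \<pi> 2 = u^2" "0 < u" "u < 1"
    using power_sum_2_bounds[OF assms] by (auto simp: u_def)
  have s3_nonneg: "0 \<le> power_sum Q \<pi> 3"
    unfolding power_sum_def using assms(1) by (intro sum_nonneg) auto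
  have "power_sum Q \<pi> 3 \<le> power_sum Q \<pi> 2 * u"
    using power_sum_3_le[of Q \<pi>] assms(1) unfolding u_def by (simp add: less_imp_le)
  also have "\<dots> = u^3"
    using s2(1) by (simp add: power3_eq_cube power2_eq_square)
  finally show ?thesis
    unfolding s2(1) by (rule cubic_cumulant_pos[OF s2(2,3) s3_nonneg])
qed

theorem corollary2:
  fixes Q :: nat and \<pi> :: "nat \<Rightarrow> real" and \<alpha> \<beta> \<alpha>' \<beta>' :: real
  assumes "Q \<ge> 2"
    and "\<forall>q<Q. 0 < \<pi> q \<and> \<pi> q < 1"
    and "(\<Sum>q<Q. \<pi> q) = 1"
    and "0 \<le> \<alpha>" "\<alpha> \<le> 1" "0 \<le> \<beta>" "\<beta> \<le> 1"
    and "0 \<le> \<alpha>'" "\<alpha>' \<le> 1" "0 \<le> \<beta>'" "\<beta>' \<le> 1"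
    and "K3_law Q \<pi> \<alpha> \<beta> = K3_law Q \<pi> \<alpha>' \<beta>'"
  shows "\<alpha> = \<alpha>' \<and> \<beta> = \<beta>'"
proof -
  note weights = assms(2,3) and same_law = assms(12)
  have W: "power_sum Q \<pi> 3 - 3 * power_sum Q \<pi> 2 * power_sum Q \<pi> 3 + 2 * power_sum Q \<pi> 2 ^ 3 \<noteq> 0"
    using power_sum_cumulant_pos[OF weights] by simp
  have "edge_prob (K3_law Q \<pi> \<alpha> \<beta>) = edge_prob (K3_law Q \<pi> \<alpha>' \<beta>')"
    and "two_star_prob (K3_law Q \<pi> \<alpha> \<beta>) = two_star_prob (K3_law Q \<pi> \<alpha>' \<beta>')"
    and "triangle_prob (K3_law Q \<pi> \<alpha> \<beta>) = triangle_prob (K3_law Q \<pi> \<alpha>' \<beta>')"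
    by (simp_all only: same_law)
  then have "\<beta> = \<beta>' \<and> \<alpha> - \<beta> = \<alpha>' - \<beta>'"
    unfolding edge_prob_K3[OF weights(2)] two_star_prob_K3[OF weights(2)]
      triangle_prob_K3[OF weights(2)]
    by (rule moments_determine_parameters[OF W])
  then show ?thesis by auto
qed
end
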